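(* Fix an integer $n\ge2$. The function $m\mapsto c_{n,m}(1)$, for integers $m\ge0$, is given by a polynomial in $m$ of degree $n-1$; write it as $$c_{n,m}(1)=\sum_{k=0}^{n-1} a_k\binom{m}{k}$$ for scalars $a_k$ depending on $n$ (this holding for all integers $m\ge 0$). Then: (a) $a_0=0$; (b) $a_1=1$; (c) $a_2=\binom{n}{\lfloor n/2\rfloor}-2$; (d) $a_{n-1}=1$; (e) $a_i$ is a positive integer for every $i\in\{1,\dots,n-1\}$.
   Context: Words are finite sequences of positive integers; for a word $w$, $|w|$ is its length and $\max w$ its largest letter. $P(w)$ is the insertion tableau of $w$ under the Robinson–Schensted–Knuth (row-insertion) correspondence. The centralizer of a word $u$ is $C(u)=\{w : P(uw)=P(wu)\}$ (juxtaposition is concatenation). Define $c_{n,m}(u)=\#\{w\in C(u) : |w|=n,\ \max w\le m\}$. It is known (from earlier work) that for fixed $n\ge2$, $c_{n,m}(1)$ is a polynomial in $m\ge0$ of degree $n-1$ with leading coefficient $1/(n-1)!$, so the expansion in the binomial basis $\binom{m}{k}$ exists and is unique. *)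

theory Defs
  imports Complex_Main "HOL-Computational_Algebra.Polynomial"
begin

text \<open>
  A word is a list of positive natural numbers. A tableau is the list of its rows, top row
  (English convention) first.
\<close>

definition is_word :: "nat list \<Rightarrow> bool" where
  "is_word w \<longleftrightarrow> (\<forall>x\<in>set w. 1 \<le> x)"

text \<open>
  The new letter replaces (and bumps out) the leftmost entry strictly greater than it; if there is
  none, it is appended to the row and nothing is bumped.
\<close>

fun row_insert :: "nat list \<Rightarrow> nat \<Rightarrow> nat list \<times> nat option" where
  "row_insert [] x = ([x], None)"
| "row_insert (y # ys) x =
     (if x < y then (x # ys, Some y)
      else (case row_insert ys x of (r, b) \<Rightarrow> (y # r, b)))"

fun tableau_insert :: "nat list list \<Rightarrow> nat \<Rightarrow> nat list list" where
  "tableau_insert [] x = [[x]]"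
| "tableau_insert (r # rs) x =
     (case row_insert r x of
        (r', None) \<Rightarrow> r' # rs
      | (r', Some y) \<Rightarrow> r' # tableau_insert rs y)"

definition insertion_tableau :: "nat list \<Rightarrow> nat list list" where
  "insertion_tableau w = foldl tableau_insert [] w"

definition centralizer :: "nat list \<Rightarrow> nat list set" where
  "centralizer u = {w. is_word w \<and> insertion_tableau (u @ w) = insertion_tableau (w @ u)}"

text \<open>
  The condition \<open>max w \<le> m\<close> is written letterwise, so that it holds vacuously for the empty word.
\<close>

definition centralizer_count :: "nat \<Rightarrow> nat \<Rightarrow> nat list \<Rightarrow> nat" where
  "centralizer_count n m u =
     card {w \<in> centralizer u. length w = n \<and> (\<forall>x\<in>set w. x \<le> m)}"

text \<open>
  The coefficient sequence is total, hence extended by \<open>0\<close> beyond degree \<open>d\<close>; this makes it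
  uniquely determined by \<open>f\<close>.
\<close>

definition binomial_expansion :: "(nat \<Rightarrow> nat) \<Rightarrow> nat \<Rightarrow> (nat \<Rightarrow> real) \<Rightarrow> bool" where
  "binomial_expansion f d a \<longleftrightarrow>
     (\<forall>m. real (f m) = (\<Sum>k=0..d. a k * real (m choose k))) \<and> (\<forall>k>d. a k = 0)"

end

theory Submission imports Defs begin

text \<open>
  A word commutes with 1 iff the first row of its tableau consists of 1s only. Whether this holds
  depends only on the positions of the 1s and on the relative order of the letters, so
  \<open>c\<^sub>n\<^sub>,\<^sub>m(1)\<close> is the sum over the sets \<open>S \<subseteq> {1..m}\<close> containing 1 of \<open>b\<^sub>|\<^sub>S\<^sub>|\<close>, the number of such words
  with letter set \<open>{1..|S|}\<close>. A fixed-point-free involution changing the number of letters by one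
  gives \<open>b\<^sub>k = e\<^sub>k + e\<^sub>k\<^sub>-\<^sub>1\<close>, where \<open>e\<^sub>k\<close> counts the words with letter set \<open>{1..k}\<close> that are sent to a
  word with \<open>k + 1\<close> letters. Distributing the two terms over \<open>S\<close> and \<open>S - {1}\<close> turns the sum into
  one over all subsets of \<open>{1..m}\<close>, so the coefficients \<open>a\<^sub>k\<close> are the counts \<open>e\<^sub>k\<close>. For two letters the
  length of the residue is a reflected walk, which gives the central binomial coefficient.
\<close>

subsection \<open>The first row of the tableau\<close>

text \<open>A letter 1 bumps the leftmost entry larger than 1, which is the head of the part without
  1s. If that part is empty, nothing is bumped, and \<open>tl [] = []\<close> covers this
  case.\<close>

definition residue_step :: "nat list \<Rightarrow> nat \<Rightarrow> nat list" where
  "residue_step r x = (if x = 1 then tl r else fst (row_insert r x))"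

text \<open>
  The residue of a word is the first row of its insertion tableau without the letters 1
  (\<open>first_row_eq\<close> below); it behaves like a row from which each 1 removes the first entry.
\<close>

definition residue :: "nat list \<Rightarrow> nat list" where
  "residue w = foldl residue_step [] w"

lemma residue_Nil [simp]: "residue [] = []"
  by (simp add: residue_def)

lemma residue_snoc [simp]: "residue (w @ [x]) = residue_step (residue w) x"
  by (simp add: residue_def)

lemma set_row_insert: "set (fst (row_insert r x)) \<subseteq> insert x (set r)"
  by (induction r) (auto split: prod.splits)

lemma length_row_insert: "length r \<le> length (fst (row_insert r x))"
  by (induction r) (auto split: prod.splits)

lemma row_insert_nonempty: "fst (row_insert r x) \<noteq> []"
  by (cases r) (auto split: prod.splits)

lemma set_residue_step: "set (residue_step r x) \<subseteq> (if x = 1 then set r else insert x (set r))"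
  using set_row_insert[of r x] by (cases r) (auto simp: residue_step_def)

lemma set_residue: "set (residue w) \<subseteq> set w - {1}"
proof (induction w rule: rev_induct)
  case (snoc x w)
  then show ?case using set_residue_step[of "residue w" x] by (auto split: if_splits)
qed simp

text \<open>Row insertion never returns an empty row, so only a letter 1 can leave the residue
  empty.\<close>

lemma last_eq_1_if_residue_Nil:
  assumes "residue w = []" "w \<noteq> []"
  shows "last w = 1"
proof (rule ccontr)
  assume "last w \<noteq> 1"
  moreover obtain u x where "w = u @ [x]"
    using assms(2) by (metis append_butlast_last_id)
  ultimately show False
    using assms(1) row_insert_nonempty by (auto simp: residue_step_def)
qed

text \<open>Every letter \<open>x\<close> passes over the leading 1s. If \<open>x = 1\<close>, it
  then replaces the head of \<open>r\<close> (or is appended) and so extends the block of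
  1s.\<close>

lemma row_insert_ones:
  assumes "1 \<le> x" "1 \<notin> set r" "0 \<notin> set r"
  shows "fst (row_insert (replicate a 1 @ r) x) =
    (if x = 1 then replicate (Suc a) 1 @ tl r else replicate a 1 @ fst (row_insert r x))"
proof (induction a)
  case 0
  show ?case
  proof (cases r)
    case (Cons y ys)
    then have "1 < y" using assms by (cases y) auto
    then show ?thesis using Cons by auto
  qed auto
next
  case (Suc a)
  then show ?case using assms(1) by (auto split: prod.splits)
qed

lemma hd_tableau_insert: "hd (tableau_insert (r # rs) x) = fst (row_insert r x)"
  by (auto split: prod.splits option.splits)

lemma tableau_insert_nonempty: "tableau_insert T x \<noteq> []"
  by (cases T) (auto split: prod.splits option.splits)

lemma foldl_tableau_insert_nonempty: "T \<noteq> [] \<Longrightarrow> foldl tableau_insert T w \<noteq> []"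
  by (induction w arbitrary: T) (auto simp: tableau_insert_nonempty)

text \<open>Starting from \<open>[[]]\<close> gives even the empty word a first row; after one
  insertion it agrees with starting from \<open>[]\<close>.\<close>

lemma first_row_eq:
  assumes "is_word w"
  shows "hd (foldl tableau_insert [[]] w) = replicate (count_list w 1) 1 @ residue w"
  using assms
proof (induction w rule: rev_induct)
  case (snoc x w)
  define T where "T = foldl tableau_insert [[]] w"
  have "T \<noteq> []" unfolding T_def by (simp add: foldl_tableau_insert_nonempty)
  then have "hd (tableau_insert T x) = fst (row_insert (hd T) x)"
    using hd_tableau_insert by (metis list.collapse)
  moreover have "0 \<notin> set (residue w)" "1 \<notin> set (residue w)" "1 \<le> x"
    using set_residue[of w] snoc.prems by (fastforce simp: is_word_def)+
  moreover have "hd T = replicate (count_list w 1) 1 @ residue w"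
    using snoc by (auto simp: T_def is_word_def)
  ultimately show ?case
    using row_insert_ones[of x "residue w" "count_list w 1"]
    by (simp add: T_def residue_step_def)
qed simp

text \<open>No letter of a word is less than 1, so a leading 1 is never bumped and does not
  influence what happens behind it.\<close>

lemma tableau_insert_one_Cons:
  assumes "1 \<le> x"
  shows "tableau_insert ((1 # r) # rs) x =
    (1 # hd (tableau_insert (r # rs) x)) # tl (tableau_insert (r # rs) x)"
  using assms by (auto split: prod.splits option.splits)

lemma foldl_tableau_insert_one_Cons:
  assumes "is_word w"
  shows "foldl tableau_insert ((1 # r) # rs) w =
    (1 # hd (foldl tableau_insert (r # rs) w)) # tl (foldl tableau_insert (r # rs) w)"
  using assms
proof (induction w rule: rev_induct)
  case (snoc x w)
  define T where "T = foldl tableau_insert (r # rs) w"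
  have "T \<noteq> []" unfolding T_def by (simp add: foldl_tableau_insert_nonempty)
  then have "T = hd T # tl T" by simp
  then show ?case
    using snoc tableau_insert_one_Cons[of x "hd T" "tl T"] by (simp add: is_word_def flip: T_def)
qed simp

text \<open>
  Prepending a letter 1 to a word prepends a 1 to the first row of its tableau; appending it does
  the same unless the insertion bumps the first letter of the residue.
\<close>

lemma centralizer_one_iff: "w \<in> centralizer [1] \<longleftrightarrow> is_word w \<and> residue w = []"
proof (cases "is_word w")
  case True
  define T where "T = foldl tableau_insert [[]] w"
  have Tne: "T \<noteq> []" unfolding T_def by (simp add: foldl_tableau_insert_nonempty)
  define r where "r = hd T"
  have T: "T = r # tl T" using Tne by (simp add: r_def)
  have r: "r = replicate (count_list w 1) 1 @ residue w"
    using first_row_eq[OF True] by (simp add: r_def T_def)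
  have left: "insertion_tableau ([1] @ w) = (1 # r) # tl T"
    using foldl_tableau_insert_one_Cons[OF True, of "[]" "[]"]
    by (simp add: insertion_tableau_def r_def T_def)
  have right: "insertion_tableau (w @ [1]) = tableau_insert T 1"
    by (cases w) (simp_all add: insertion_tableau_def T_def)
  have res: "1 \<notin> set (residue w)" "0 \<notin> set (residue w)"
    using set_residue[of w] True by (fastforce simp: is_word_def)+
  have fst: "fst (row_insert r 1) = replicate (Suc (count_list w 1)) 1 @ tl (residue w)"
    using row_insert_ones[OF _ res, of 1] by (simp add: r)
  show ?thesis
  proof (cases "residue w = []")
    case Nil: True
    have "row_insert (replicate a 1) 1 = (replicate (Suc a) (1::nat), None)" for a
      by (induction a) auto
    then have "tableau_insert T 1 = (1 # r) # tl T"
      by (subst T) (simp add: r Nil)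
    then show ?thesis using True Nil left right by (simp add: centralizer_def)
  next
    case False
    \<comment> \<open>The additional 1 takes the place of the bumped head of the residue, so the row
      keeps its length, whereas \<open>1 # r\<close> is longer by one.\<close>
    then have "length (fst (row_insert r 1)) = length r"
      by (subst fst) (simp add: r)
    then have "tableau_insert T 1 \<noteq> (1 # r) # tl T"
      by (metis T hd_tableau_insert length_Cons list.sel(1) n_not_Suc_n)
    then show ?thesis using False left right by (metis (mono_tags, lifting) centralizer_def mem_Collect_eq)
  qed
qed (simp add: centralizer_def)

section \<open>Relabelling letters\<close>

lemma row_insert_map:
  assumes "\<forall>y\<in>set r. h x < h y \<longleftrightarrow> x < y"
  shows "fst (row_insert (map h r) (h x)) = map h (fst (row_insert r x))"
  using assms by (induction r) (auto split: prod.splits)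

text \<open>Insertion compares a new letter \<open>x\<close> only with earlier letters
  \<open>y\<close>, and only by \<open>x < y\<close>. Hence \<open>h\<close> has to respect just
  these comparisons and may merge letters.\<close>

lemma residue_map:
  assumes "sorted_wrt (\<lambda>y x. h x < h y \<longleftrightarrow> x < y) w" "\<forall>x\<in>set w. h x = 1 \<longleftrightarrow> x = 1"
  shows "residue (map h w) = map h (residue w)"
  using assms
proof (induction w rule: rev_induct)
  case (snoc x w)
  then have "\<forall>y\<in>set (residue w). h x < h y \<longleftrightarrow> x < y"
    using set_residue[of w] by (auto simp: sorted_wrt_append)
  with snoc show ?case
    by (auto simp: sorted_wrt_append residue_step_def row_insert_map map_tl)
qed simp

subsection \<open>Collapsing letters\<close>

text \<open>
  Order the positions of a word by letter, and equal letters from left to right. A tie or a rise at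
  a letter \<open>l\<close> means that the leftmost \<open>l\<close> and its successor in this order stand from
  left to right, with successor again \<open>l\<close> or a strictly larger \<open>l + 1\<close>. Collapsing \<open>l + 1\<close> into \<open>l\<close>
  turns a rise into a tie without changing the order.
\<close>

definition tie :: "nat list \<Rightarrow> nat \<Rightarrow> bool" where
  "tie w l \<longleftrightarrow> (\<exists>u v. w = u @ l # v \<and> l \<notin> set u \<and> l \<in> set v)"

definition rise :: "nat list \<Rightarrow> nat \<Rightarrow> bool" where
  "rise w l \<longleftrightarrow> (\<exists>u v. w = u @ l # v \<and> l \<notin> set u \<and> l \<notin> set v \<and>
     Suc l \<notin> set u \<and> Suc l \<in> set v)"

definition ascent :: "nat list \<Rightarrow> nat \<Rightarrow> bool" where
  "ascent w l \<longleftrightarrow> 2 \<le> l \<and> (tie w l \<or> rise w l)"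

definition collapse :: "nat \<Rightarrow> nat \<Rightarrow> nat" where
  "collapse l x = (if x \<le> l then x else x - 1)"

definition lift :: "nat \<Rightarrow> nat \<Rightarrow> nat" where
  "lift l x = (if x < l then x else Suc x)"

lemma collapse_self [simp]: "collapse l l = l"
  by (simp add: collapse_def)

text \<open>The intended inverse of collapsing: since only the leftmost \<open>l\<close> keeps its
  value, its other copies become the letters \<open>Suc l\<close> of a rise.\<close>

fun expand :: "nat \<Rightarrow> nat list \<Rightarrow> nat list" where
  "expand l [] = []"
| "expand l (x # xs) = (if x = l then l # map (lift l) xs else lift l x # expand l xs)"

lemma expand_split: "l \<notin> set u \<Longrightarrow> expand l (u @ l # v) = map (lift l) u @ l # map (lift l) v"
  by (induction u) auto

lemma length_expand [simp]: "length (expand l w) = length w"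
  by (induction w) auto

lemma map_collapse_expand [simp]: "map (collapse l) (expand l w) = w"
proof -
  have [simp]: "collapse l (lift l x) = x" for x by (simp add: collapse_def lift_def)
  have "collapse l \<circ> lift l = id" by auto
  then show ?thesis by (induction w) auto
qed

lemma rise_expand:
  assumes "tie w l"
  shows "rise (expand l w) l"
proof -
  obtain u v where w: "w = u @ l # v" "l \<notin> set u" "l \<in> set v"
    using assms by (auto simp: tie_def)
  have "l \<notin> set (map (lift l) u)" "l \<notin> set (map (lift l) v)"
    by (auto simp: lift_def)
  moreover have "Suc l \<notin> set (map (lift l) u)" "Suc l \<in> set (map (lift l) v)"
    using w by (force simp: lift_def)+
  ultimately show ?thesis
    unfolding rise_def w(1) expand_split[OF w(2)] by blast
qed

lemma tie_collapse:
  assumes "rise w l"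
  shows "tie (map (collapse l) w) l"
proof -
  obtain u v where w: "w = u @ l # v" "l \<notin> set u" "Suc l \<notin> set u" "Suc l \<in> set v"
    using assms by (auto simp: rise_def)
  have "l \<notin> set (map (collapse l) u)"
  proof
    assume "l \<in> set (map (collapse l) u)"
    then obtain x where x: "x \<in> set u" "collapse l x = l" by auto
    then have "x = l \<or> x = Suc l" by (auto simp: collapse_def split: if_splits)
    with x w show False by auto
  qed
  moreover have "l \<in> set (map (collapse l) v)"
    using w(4) by (force simp: collapse_def)
  moreover have "map (collapse l) w = map (collapse l) u @ l # map (collapse l) v"
    by (simp add: w(1))
  ultimately show ?thesis unfolding tie_def by blast
qed

lemma expand_collapse:
  assumes "rise w l"
  shows "expand l (map (collapse l) w) = w"
proof -
  obtain u v where w: "w = u @ l # v" "l \<notin> set u" "Suc l \<notin> set u" "l \<notin> set v"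
    using assms by (auto simp: rise_def)
  have u: "l \<notin> collapse l ` set u"
  proof
    assume "l \<in> collapse l ` set u"
    then obtain x where x: "x \<in> set u" "collapse l x = l" by auto
    then have "x = l \<or> x = Suc l" by (auto simp: collapse_def split: if_splits)
    with x w show False by auto
  qed
  have *: "lift l (collapse l x) = x" if "x \<noteq> l" for x
    using that by (auto simp: lift_def collapse_def)
  have "map (lift l) (map (collapse l) xs) = xs" if "l \<notin> set xs" for xs
    using that by (induction xs) (auto simp: *)
  with w u show ?thesis
    using expand_split[of l "map (collapse l) u" "map (collapse l) v"] by (simp add: collapse_def)
qed

lemma rise_before:
  assumes "rise w l" "w = u @ Suc l # v"
  shows "l \<in> set u"
proof -
  obtain u' v' where w: "w = u' @ l # v'" "Suc l \<notin> set u'"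
    using assms by (auto simp: rise_def)
  then show ?thesis using assms(2)
    by (auto simp: append_eq_append_conv2 append_eq_Cons_conv Cons_eq_append_conv)
qed

text \<open>Collapsing alters a comparison only if \<open>y = Suc l\<close> stands before
  \<open>x = l\<close>. In a rise the unique \<open>l\<close> precedes every \<open>Suc l\<close>,
  so this pair never arises.\<close>

lemma rise_collapse_order:
  assumes "rise w l"
  shows "sorted_wrt (\<lambda>y x. collapse l x < collapse l y \<longleftrightarrow> x < y) w"
proof -
  obtain u v where w: "w = u @ l # v" "l \<notin> set u" "Suc l \<notin> set u" "l \<notin> set v"
    using assms by (auto simp: rise_def)
  have *: "collapse l x < collapse l y \<longleftrightarrow> x < y" if "x \<noteq> l \<or> y \<noteq> Suc l" for x y
    using that by (auto simp: collapse_def)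
  have **: "sorted_wrt (\<lambda>y x. collapse l x < collapse l y \<longleftrightarrow> x < y) xs" if "l \<notin> set xs" for xs
    by (rule sorted_wrt_mono_rel[of xs "\<lambda>_ _. True"]) (metis that *, simp)
  show ?thesis
    unfolding w(1) sorted_wrt_append sorted_wrt.simps
  proof (intro conjI ballI)
    show "collapse l x < collapse l y \<longleftrightarrow> x < y" if "y \<in> set u" "x \<in> set (l # v)" for x y
      using that w(3) * by metis
    show "collapse l x < collapse l l \<longleftrightarrow> x < l" for x
      by (rule *) simp
  qed (use w(2,4) ** in blast)+
qed

text \<open>Because \<open>2 \<le> l\<close>, no other letter is merged with 1, whose role in the
  residue is special.\<close>

lemma residue_collapse:
  assumes "rise w l" "2 \<le> l"
  shows "residue (map (collapse l) w) = map (collapse l) (residue w)"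
  by (rule residue_map) (use assms rise_collapse_order in \<open>auto simp: collapse_def\<close>)

text \<open>A rise contains both \<open>l\<close> and \<open>Suc l\<close>, so merging them reduces
  the number of letters by exactly one and leaves no gap.\<close>

lemma set_collapse_iff:
  assumes "rise w l" "1 \<le> l"
  shows "set (map (collapse l) w) = {1..k} \<longleftrightarrow> set w = {1..Suc k}"
proof -
  have l: "l \<in> set w" "Suc l \<in> set w" using assms(1) by (auto simp: rise_def)
  show ?thesis
  proof
    assume S: "set (map (collapse l) w) = {1..k}"
    have "l \<le> k"
      using S l(1) collapse_self[of l] by (metis atLeastAtMost_iff image_eqI set_map)
    have "x \<in> {1..Suc k}" if "x \<in> set w" for x
    proof -
      have "collapse l x \<in> {1..k}" using S that by auto
      then show ?thesis using assms(2) by (auto simp: collapse_def split: if_splits)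
    qed
    moreover have "y \<in> set w" if "y \<in> {1..Suc k}" for y
    proof (cases "y = l \<or> y = Suc l")
      case False
      then have "collapse l y \<in> {1..k}"
        using that \<open>l \<le> k\<close> by (auto simp: collapse_def)
      then obtain x where x: "x \<in> set w" "collapse l x = collapse l y"
        using S by (metis (mono_tags) imageE set_map)
      with False have "x = y" by (auto simp: collapse_def split: if_splits)
      then show ?thesis using x by simp
    qed (use l in auto)
    ultimately show "set w = {1..Suc k}" by blast
  next
    assume S: "set w = {1..Suc k}"
    have "collapse l ` {1..Suc k} = {1..k}"
    proof
      show "collapse l ` {1..Suc k} \<subseteq> {1..k}"
        using l S assms(2) by (auto simp: collapse_def)
      show "{1..k} \<subseteq> collapse l ` {1..Suc k}"
      proof
        fix y assume y: "y \<in> {1..k}"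
        show "y \<in> collapse l ` {1..Suc k}"
          by (rule image_eqI[of _ _ "if y \<le> l then y else Suc y"]) (use y in \<open>auto simp: collapse_def\<close>)
      qed
    qed
    then show "set (map (collapse l) w) = {1..k}" using S by simp
  qed
qed

text \<open>Ensures that the least ascent remains the least one when a rise there becomes a tie, so
  that the involution can find it again.\<close>

lemma ascent_collapse_iff:
  assumes "rise w l" "i < l"
  shows "ascent (map (collapse l) w) i \<longleftrightarrow> ascent w i"
proof -
  have eq: "collapse l x = j \<longleftrightarrow> x = j" if "j < l" for x j
    using that by (auto simp: collapse_def)
  have eql: "collapse l x = l \<longleftrightarrow> x = l \<or> x = Suc l" for x
    by (auto simp: collapse_def)
  have mem: "j \<in> set (map (collapse l) xs) \<longleftrightarrow> j \<in> set xs" if "j < l" for xs j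
    using eq[OF that] by (metis (no_types) imageE image_eqI set_map)
  have meml: "l \<in> set (map (collapse l) xs) \<longleftrightarrow> l \<in> set xs \<or> Suc l \<in> set xs" for xs
    using eql by (metis (no_types) imageE image_eqI set_map)
  have split: "(\<exists>u v. map (collapse l) w = u @ i # v \<and> P u v) \<longleftrightarrow>
      (\<exists>u v. w = u @ i # v \<and> P (map (collapse l) u) (map (collapse l) v))" for P
  proof
    assume "\<exists>u v. map (collapse l) w = u @ i # v \<and> P u v"
    then obtain u z v where "w = u @ z # v" "collapse l z = i"
        "P (map (collapse l) u) (map (collapse l) v)"
      by (auto simp: map_eq_append_conv map_eq_Cons_conv)
    then show "\<exists>u v. w = u @ i # v \<and> P (map (collapse l) u) (map (collapse l) v)"
      using eq[OF assms(2)] by blast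
  next
    assume "\<exists>u v. w = u @ i # v \<and> P (map (collapse l) u) (map (collapse l) v)"
    then obtain u v where uv: "w = u @ i # v" "P (map (collapse l) u) (map (collapse l) v)"
      by blast
    then have "map (collapse l) w = map (collapse l) u @ i # map (collapse l) v"
      using eq[OF assms(2), of i] by simp
    with uv(2) show "\<exists>u v. map (collapse l) w = u @ i # v \<and> P u v" by blast
  qed
  have "tie (map (collapse l) w) i \<longleftrightarrow> tie w i"
    unfolding tie_def split mem[OF assms(2)] by blast
  moreover have "rise (map (collapse l) w) i \<longleftrightarrow> rise w i"
  proof (cases "Suc i < l")
    case True
    then show ?thesis unfolding rise_def split mem[OF assms(2)] mem[OF True] by blast
  next
    case False
    then have Suc: "Suc i = l" using assms(2) by simp
    \<comment> \<open>After collapsing, \<open>l\<close> also stands for the former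
      \<open>Suc l\<close>. As each \<open>Suc l\<close> has an \<open>l\<close> to its left, this
      does not change whether \<open>l\<close> occurs before \<open>i\<close>.\<close>
    have "(Suc l \<in> set u \<longrightarrow> l \<in> set u) \<and> (Suc l \<in> set v \<longrightarrow> l \<in> set u \<or> l \<in> set v)"
      if "w = u @ i # v" for u v
    proof (intro conjI impI)
      assume "Suc l \<in> set u"
      then obtain u1 u2 where "u = u1 @ Suc l # u2" by (auto simp: in_set_conv_decomp)
      then show "l \<in> set u" using rise_before[OF assms(1), of u1] that by auto
    next
      assume "Suc l \<in> set v"
      then obtain u1 u2 where "v = u1 @ Suc l # u2" by (auto simp: in_set_conv_decomp)
      then show "l \<in> set u \<or> l \<in> set v"
        using rise_before[OF assms(1), of "u @ i # u1"] that Suc by auto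
    qed
    then show ?thesis unfolding rise_def split mem[OF assms(2)] Suc meml by blast
  qed
  ultimately show ?thesis by (simp add: ascent_def)
qed

subsection \<open>The involution\<close>

text \<open>For letter sets \<open>{1..k}\<close> these are the words without ascent, on which the
  involution must act at the first letter.\<close>

definition falling :: "nat list \<Rightarrow> bool" where
  "falling w \<longleftrightarrow> sorted_wrt (>) (filter (\<lambda>x. x \<noteq> 1) w)"

lemma tie_iff_count_list: "tie w l \<longleftrightarrow> 2 \<le> count_list w l"
proof
  assume "tie w l"
  then obtain u v where "w = u @ l # v" "l \<in> set v" by (auto simp: tie_def)
  then show "2 \<le> count_list w l" by (auto simp: Suc_le_eq count_list_0_iff intro!: Nat.gr0I)
next
  assume *: "2 \<le> count_list w l"
  then have "l \<in> set w" using count_list_0_iff[of w l] by fastforce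
  then obtain u v where uv: "w = u @ l # v" "l \<notin> set u" by (auto dest: split_list_first)
  then have "l \<in> set v" using * count_list_0_iff[of v l] count_list_0_iff[of u l] by fastforce
  with uv show "tie w l" by (auto simp: tie_def)
qed

lemma sorted_wrt_filterI:
  assumes "\<And>u x v y. w = u @ x # v \<Longrightarrow> Q x \<Longrightarrow> y \<in> set v \<Longrightarrow> Q y \<Longrightarrow> P x y"
  shows "sorted_wrt P (filter Q w)"
  using assms
proof (induction w)
  case (Cons z w)
  have "sorted_wrt P (filter Q w)"
    by (rule Cons.IH) (metis Cons.prems append_Cons)
  moreover have "P z y" if "Q z" "y \<in> set w" "Q y" for y
    using Cons.prems[of "[]" z w y] that by simp
  ultimately show ?case by auto
qed simp

lemma no_ascent_iff_falling:
  assumes "set w = {1..k}"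
  shows "(\<forall>l. \<not> ascent w l) \<longleftrightarrow> falling w"
proof
  assume "falling w"
  show "\<forall>l. \<not> ascent w l"
  proof (intro allI notI)
    fix l assume "ascent w l"
    then obtain u v where uv: "2 \<le> l" "w = u @ l # v" "l \<in> set v \<or> Suc l \<in> set v"
      by (auto simp: ascent_def tie_def rise_def)
    then have "\<forall>y\<in>set v. y \<noteq> 1 \<longrightarrow> y < l"
      using \<open>falling w\<close> by (auto simp: falling_def sorted_wrt_append)
    then show False using uv by fastforce
  qed
next
  assume no: "\<forall>l. \<not> ascent w l"
  have once: "x \<notin> set u \<and> x \<notin> set v" if "w = u @ x # v" "2 \<le> x" for u v x
  proof -
    have "count_list w x < 2" using no that(2) by (force simp: ascent_def tie_iff_count_list)
    then have "count_list u x = 0" "count_list v x = 0" using that(1) by auto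
    then show ?thesis by (simp add: count_list_0_iff)
  qed
  have next_before: "Suc x \<in> set u" if "w = u @ x # v" "2 \<le> x" "Suc x \<le> k" for u v x
  proof (rule ccontr)
    assume "Suc x \<notin> set u"
    moreover have "Suc x \<in> set w" using assms that(3) by auto
    ultimately have "rise w x" using once[OF that(1,2)] that(1) unfolding rise_def by auto
    then show False using no that(2) by (simp add: ascent_def)
  qed
  \<comment> \<open>Iterating \<open>next_before\<close> puts all letters above \<open>x\<close> to
    its left, so whatever stands to its right is smaller.\<close>
  have chain: "Suc (x + d) \<in> set u" if "w = u @ x # v" "2 \<le> x" "Suc (x + d) \<le> k" for u x v d
    using that
  proof (induction d arbitrary: u v)
    case 0
    then show ?case using next_before by simp
  next
    case (Suc d)
    then have "Suc (x + d) \<in> set u" by simp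
    then obtain u1 u2 where u: "u = u1 @ Suc (x + d) # u2" by (auto simp: in_set_conv_decomp)
    let ?y = "Suc (x + d)"
    have w: "w = u1 @ ?y # (u2 @ x # v)" using Suc.prems(1) u by simp
    have "Suc ?y \<in> set u1" using next_before[OF w] Suc.prems by simp
    then show ?case using u by simp
  qed
  show "falling w" unfolding falling_def
  proof (rule sorted_wrt_filterI)
    fix u x v y assume w: "w = u @ x # v" "x \<noteq> 1" "y \<in> set v" "y \<noteq> 1"
    then have "x \<in> set w" "y \<in> set w" by auto
    then have xy: "2 \<le> x" "2 \<le> y" "y \<le> k" using assms w(2,4) by auto
    have "y \<notin> set u"
    proof
      assume "y \<in> set u"
      then obtain u1 u2 where "u = u1 @ y # u2" by (auto simp: in_set_conv_decomp)
      with w once[of u1 y "u2 @ x # v"] xy show False by auto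
    qed
    moreover have "y \<noteq> x" using once[OF w(1)] xy w by auto
    ultimately show "y < x"
      using chain[OF w(1) xy(1), of "y - Suc x"] xy(3) by (cases "x < y") auto
  qed
qed

text \<open>A letter other than 1 either enters an empty residue or replaces its single, larger
  entry; a letter 1 empties it. The residue never grows beyond one entry.\<close>

lemma residue_falling:
  assumes "falling w" "w \<noteq> []"
  shows "residue w = (if last w = 1 then [] else [last w])"
  using assms
proof (induction w rule: rev_induct)
  case (snoc x w)
  show ?case
  proof (cases "w = []")
    case False
    have "falling w" using snoc.prems by (simp add: falling_def sorted_wrt_append)
    moreover have "x < last w" if "x \<noteq> 1" "last w \<noteq> 1"
      using snoc.prems that False by (auto simp: falling_def sorted_wrt_append)
    ultimately show ?thesis using snoc.IH False by (auto simp: residue_step_def)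
  qed (simp add: residue_def residue_step_def)
qed simp

text \<open>Without 1s the residue never shrinks, so the bound holds for all prefixes, and a letter
  that is not smaller than its predecessor would be appended.\<close>

lemma decreasing_if_length_residue_le_1:
  assumes "1 \<notin> set u" "length (residue u) \<le> 1"
  shows "sorted_wrt (>) u"
  using assms
proof (induction u rule: rev_induct)
  case (snoc x u)
  have filter: "filter (\<lambda>y. y \<noteq> 1) u = u" using snoc.prems(1) by (auto simp: filter_id_conv)
  have "length (residue u) \<le> 1"
    using snoc.prems length_row_insert[of "residue u" x] by (simp add: residue_step_def)
  then have dec: "sorted_wrt (>) u" using snoc by simp
  show ?case
  proof (cases "u = []")
    case False
    then obtain u' z where u: "u = u' @ [z]" by (metis append_butlast_last_id)
    have "residue u = [z]"
      using residue_falling[of u] dec False filter snoc.prems(1) u by (simp add: falling_def)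
    then have "length (fst (row_insert [z] x)) \<le> 1"
      using snoc.prems by (simp add: residue_step_def split: if_splits)
    then have "x < z" by (simp split: if_splits)
    then show ?thesis using dec u by (auto simp: sorted_wrt_append)
  qed simp
qed simp

text \<open>The only 1 is the last letter, and it removes at most one entry; so the residue before
  it has length at most 1. This serves the leading coefficient.\<close>

lemma falling_if_single_one:
  assumes "residue w = []" "count_list w 1 = 1"
  shows "falling w"
proof -
  have "w \<noteq> []" using assms(2) by auto
  then obtain u where u: "w = u @ [1]"
    using last_eq_1_if_residue_Nil[OF assms(1)] by (metis append_butlast_last_id)
  then have "1 \<notin> set u" using assms(2) by (simp add: count_list_0_iff)
  moreover have "length (residue u) \<le> 1"
    using assms(1) u by (cases "residue u") (auto simp: residue_step_def)
  ultimately have "sorted_wrt (>) u" by (rule decreasing_if_length_residue_le_1)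
  moreover have "filter (\<lambda>x. x \<noteq> 1) w = u"
    using \<open>1 \<notin> set u\<close> u by (auto simp: filter_id_conv)
  ultimately show ?thesis by (simp add: falling_def)
qed

text \<open>For a set \<open>S\<close> of positive integers: the words of length \<open>n\<close>
  commuting with 1 whose letter set is exactly \<open>S\<close>.\<close>

definition residue_free :: "nat \<Rightarrow> nat set \<Rightarrow> nat list set" where
  "residue_free n S = {w. length w = n \<and> set w = S \<and> residue w = []}"

text \<open>
  The involution behind the positivity: at the least ascent, exchange a tie with a rise; if there is
  no ascent, exchange a leading 1 with a new leading maximum. It changes the number of letters by
  one; the lower words are those that gain a letter.
\<close>

definition lower :: "nat list \<Rightarrow> bool" where
  "lower w \<longleftrightarrow> (if \<exists>l. ascent w l then tie w (LEAST l. ascent w l) else hd w = 1)"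

definition lower_count :: "nat \<Rightarrow> nat \<Rightarrow> nat" where
  "lower_count n k = card {w \<in> residue_free n {1..k}. lower w}"

lemma finite_residue_free: "finite S \<Longrightarrow> finite (residue_free n S)"
  by (rule finite_subset[OF _ finite_lists_length_eq[of S n]]) (auto simp: residue_free_def)

definition lower_word :: "nat list \<Rightarrow> nat list" where
  "lower_word w = (if \<exists>l. ascent w l then map (collapse (LEAST l. ascent w l)) w else 1 # tl w)"

text \<open>The parameter \<open>k\<close> is the number of letters of the given word, which
  determines the new maximum.\<close>

definition raise_word :: "nat \<Rightarrow> nat list \<Rightarrow> nat list" where
  "raise_word k w = (if \<exists>l. ascent w l then expand (LEAST l. ascent w l) w else Suc k # tl w)"

lemma least_ascent_collapse:
  assumes "rise w l" "2 \<le> l" "\<forall>i<l. \<not> ascent w i"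
  shows "ascent (map (collapse l) w) l" "(LEAST i. ascent (map (collapse l) w) i) = l"
proof -
  show "ascent (map (collapse l) w) l"
    using tie_collapse[OF assms(1)] assms(2) by (simp add: ascent_def)
  then show "(LEAST i. ascent (map (collapse l) w) i) = l"
    by (rule Least_equality) (metis assms(1,3) ascent_collapse_iff not_less)
qed

text \<open>A word that is not lower has a rise at its least ascent or, without ascents, starts with
  its maximum. In the second case \<open>2 \<le> n\<close> keeps the first letter apart from the
  final 1.\<close>

lemma raise_lower_word:
  assumes "2 \<le> n" "w \<in> residue_free n {1..Suc k}" "\<not> lower w"
  shows "lower_word w \<in> residue_free n {1..k} \<and> lower (lower_word w) \<and>
    raise_word k (lower_word w) = w"
proof (cases "\<exists>l. ascent w l")
  case True
  define l where "l = (LEAST l. ascent w l)"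
  have l: "ascent w l" "\<forall>i<l. \<not> ascent w i"
    unfolding l_def using LeastI_ex[OF True] by (blast dest: not_less_Least)+
  have "\<not> tie w l" using assms(3) True by (simp add: lower_def l_def)
  then have r: "rise w l" "2 \<le> l" using l(1) by (auto simp: ascent_def)
  let ?w = "map (collapse l) w"
  have "lower_word w = ?w" using True by (simp add: lower_word_def l_def)
  moreover have "?w \<in> residue_free n {1..k}"
    using assms(2) set_collapse_iff[OF r(1)] residue_collapse[OF r] r(2)
    unfolding residue_free_def by simp
  moreover have "lower ?w" "raise_word k ?w = w"
    using least_ascent_collapse[OF r l(2)] tie_collapse[OF r(1)] expand_collapse[OF r(1)]
    by (auto simp: lower_def raise_word_def)
  ultimately show ?thesis by simp
next
  case False
  have w: "length w = n" "set w = {1..Suc k}" "residue w = []"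
    using assms(2) by (auto simp: residue_free_def)
  have fall: "falling w" using no_ascent_iff_falling[OF w(2)] False by blast
  obtain x t where xt: "w = x # t" "t \<noteq> []"
    using w(1) assms(1) by (cases w; cases "tl w") auto
  have "x \<noteq> 1" using assms(3) False xt by (simp add: lower_def)
  have last: "last t = 1" using last_eq_1_if_residue_Nil[OF w(3)] xt by auto
  then have "1 \<in> set t" using xt(2) last_in_set by metis
  have less: "\<forall>y\<in>set t. y \<noteq> 1 \<longrightarrow> y < x"
    using fall xt \<open>x \<noteq> 1\<close> by (auto simp: falling_def)
  \<comment> \<open>The later letters other than 1 are smaller than \<open>x\<close>, so the maximum
    can only be \<open>x\<close>, and it occurs once.\<close>
  have "x = Suc k"
  proof -
    have "x \<in> {1..Suc k}" "Suc k \<in> insert x (set t)" using w(2) xt(1) by auto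
    then show ?thesis using less \<open>x \<noteq> 1\<close> by fastforce
  qed
  have "Suc k \<notin> set t" using less \<open>x = Suc k\<close> \<open>x \<noteq> 1\<close> by auto
  moreover have "insert (Suc k) (set t) = insert (Suc k) {1..k}"
    using w(2) xt(1) \<open>x = Suc k\<close> by (simp add: atLeastAtMostSuc_conv)
  ultimately have sett: "set t = {1..k}" by (subst (asm) insert_ident) auto
  then have set1: "set (1 # t) = {1..k}" using \<open>1 \<in> set t\<close> by (metis insert_absorb list.set(2))
  have fall1: "falling (1 # t)" using fall xt \<open>x \<noteq> 1\<close> by (simp add: falling_def)
  then have no: "\<nexists>l. ascent (1 # t) l" using no_ascent_iff_falling[OF set1] by blast
  have "residue (1 # t) = []" using residue_falling[OF fall1] last xt(2) by simp
  then show ?thesis using False no set1 xt w(1) \<open>x = Suc k\<close>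
    by (auto simp: lower_word_def raise_word_def lower_def residue_free_def)
qed

lemma lower_raise_word:
  assumes "2 \<le> n" "w \<in> residue_free n {1..k}" "lower w"
  shows "raise_word k w \<in> residue_free n {1..Suc k} \<and> \<not> lower (raise_word k w) \<and>
    lower_word (raise_word k w) = w"
proof (cases "\<exists>l. ascent w l")
  case True
  define l where "l = (LEAST l. ascent w l)"
  define w' where "w' = expand l w"
  have l: "ascent w l" "\<forall>i<l. \<not> ascent w i"
    unfolding l_def using LeastI_ex[OF True] by (blast dest: not_less_Least)+
  have t: "tie w l" "2 \<le> l"
    using assms(3) True l(1) by (simp_all add: lower_def ascent_def flip: l_def)
  have r: "rise w' l" unfolding w'_def using rise_expand[OF t(1)] .
  have w: "map (collapse l) w' = w" by (simp add: w'_def)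
  have asc: "ascent w' l" using r t(2) by (simp add: ascent_def)
  \<comment> \<open>The result on collapsing is applied to \<open>w'\<close>, whose collapse is
    \<open>w\<close>; no separate analysis of \<open>expand\<close> is required.\<close>
  have "\<forall>i<l. \<not> ascent w' i" using l(2) ascent_collapse_iff[OF r] w by simp
  then have least: "(LEAST i. ascent w' i) = l"
    using asc by (intro Least_equality) (auto simp: not_less[symmetric])
  have "\<not> tie w' l"
    using r by (auto simp: rise_def tie_iff_count_list count_list_0_iff[symmetric])
  then have "\<not> lower w'" "lower_word w' = w"
    using asc least w by (auto simp: lower_def lower_word_def)
  moreover have "w' \<in> residue_free n {1..Suc k}"
  proof -
    have "residue w' = []" using residue_collapse[OF r t(2)] w assms(2) by (simp add: residue_free_def)
    moreover have "set w' = {1..Suc k}"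
      using set_collapse_iff[OF r] t(2) w assms(2) by (simp add: residue_free_def)
    ultimately show ?thesis using assms(2) by (simp add: residue_free_def w'_def)
  qed
  moreover have "raise_word k w = w'" using True by (simp add: raise_word_def l_def w'_def)
  ultimately show ?thesis by simp
next
  case False
  have w: "length w = n" "set w = {1..k}" "residue w = []"
    using assms(2) by (auto simp: residue_free_def)
  have fall: "falling w" using no_ascent_iff_falling[OF w(2)] False by blast
  have "hd w = 1" using assms(3) False by (simp add: lower_def)
  then obtain t where t: "w = 1 # t" "t \<noteq> []"
    using w(1) assms(1) by (cases w; cases "tl w") auto
  have last: "last t = 1" using last_eq_1_if_residue_Nil[OF w(3)] t by auto
  \<comment> \<open>The final 1 survives the replacement of the leading 1, so no letter is
    lost.\<close>
  then have "1 \<in> set t" using t(2) last_in_set by metis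
  then have sett: "set t = {1..k}" using w(2) t by (simp add: insert_absorb)
  then have "Suc k \<noteq> 1" using \<open>1 \<in> set t\<close> by auto
  have set1: "set (Suc k # t) = {1..Suc k}" using sett by auto
  have fall1: "falling (Suc k # t)"
    using fall t sett \<open>Suc k \<noteq> 1\<close> by (auto simp: falling_def)
  then have no: "\<nexists>l. ascent (Suc k # t) l" using no_ascent_iff_falling[OF set1] by blast
  have "residue (Suc k # t) = []" using residue_falling[OF fall1] last t(2) by simp
  then show ?thesis using False no set1 t w(1) \<open>Suc k \<noteq> 1\<close>
    by (auto simp: lower_word_def raise_word_def lower_def residue_free_def)
qed

lemma card_residue_free:
  assumes "2 \<le> n"
  shows "card (residue_free n {1..Suc k}) = lower_count n (Suc k) + lower_count n k"
proof -
  let ?W = "residue_free n {1..Suc k}"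
  have "bij_betw lower_word {w \<in> ?W. \<not> lower w} {w \<in> residue_free n {1..k}. lower w}"
    by (rule bij_betw_byWitness[where f' = "raise_word k"])
       (use raise_lower_word[OF assms] lower_raise_word[OF assms] in auto)
  then have "card {w \<in> ?W. \<not> lower w} = lower_count n k"
    unfolding lower_count_def by (rule bij_betw_same_card)
  moreover have "card ?W = card {w \<in> ?W. lower w} + card {w \<in> ?W. \<not> lower w}"
    by (subst card_Un_disjoint[symmetric])
       (auto simp: finite_residue_free intro!: arg_cong[of _ _ card])
  ultimately show ?thesis by (simp add: lower_count_def)
qed

subsection \<open>The binomial expansion\<close>

text \<open>The increasing bijection from \<open>{1..card S}\<close> to \<open>S\<close> preserves
  all comparisons, and it fixes 1 because 1 is the least element of \<open>S\<close>.\<close>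

lemma card_residue_free_relabel:
  assumes "finite S" "1 \<in> S" "0 \<notin> S"
  shows "card (residue_free n S) = card (residue_free n {1..card S})"
proof -
  obtain h0 where h0: "bij_betw h0 {..<card S} S" "strict_mono_on {..<card S} h0"
    using ex_bij_betw_strict_mono_card[OF assms(1)] by blast
  define h where "h = h0 \<circ> (\<lambda>x. x - 1)"
  have "bij_betw (\<lambda>x. x - 1) {1..card S} {..<card S}"
    by (rule bij_betw_byWitness[where f' = Suc]) auto
  then have bij: "bij_betw h {1..card S} S"
    unfolding h_def using h0(1) by (rule bij_betw_trans)
  have mono: "h x < h y \<longleftrightarrow> x < y" if "x \<in> {1..card S}" "y \<in> {1..card S}" for x y
  proof -
    have "x - 1 \<in> {..<card S}" "y - 1 \<in> {..<card S}" "x - 1 < y - 1 \<longleftrightarrow> x < y"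
      using that by auto
    then show ?thesis using strict_mono_on_less[OF h0(2), of "x - 1" "y - 1"] by (simp add: h_def)
  qed
  have pos: "0 < card S" using assms by (auto simp: card_gt_0_iff)
  have one: "h x = 1 \<longleftrightarrow> x = 1" if x: "x \<in> {1..card S}" for x
  proof -
    obtain y where y: "y \<in> {1..card S}" "h y = 1"
      using bij assms(2) by (metis bij_betw_imp_surj_on imageE)
    have "y = 1"
    proof (rule ccontr)
      assume "y \<noteq> 1"
      then have "h 1 < h y" using mono[of 1 y] y(1) pos by auto
      then have "h 1 = 0" using y(2) by simp
      moreover have "h 1 \<in> S" using bij pos by (auto simp: bij_betw_def)
      ultimately show False using assms(3) by simp
    qed
    then show ?thesis using y x bij by (metis bij_betw_inv_into_left)
  qed
  have res: "residue (map h w) = map h (residue w)" if "set w = {1..card S}" for w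
  proof (rule residue_map)
    show "sorted_wrt (\<lambda>y x. h x < h y \<longleftrightarrow> x < y) w"
      by (rule sorted_wrt_mono_rel[of w "\<lambda>_ _. True"]) (use that mono in auto)
  qed (use that one in auto)
  define g where "g = inv_into {1..card S} h"
  have gh: "map g (map h w) = w" if "set w = {1..card S}" for w
    using that bij by (auto simp: g_def bij_betw_inv_into_left intro!: map_idI)
  have hg: "map h (map g w) = w" if "set w = S" for w
    using that bij by (auto simp: g_def bij_betw_inv_into_right intro!: map_idI)
  have setg: "set (map g w) = {1..card S}" if "set w = S" for w
    using that bij bij_betw_inv_into[OF bij] by (simp add: g_def bij_betw_def)
  have "bij_betw (map h) (residue_free n {1..card S}) (residue_free n S)"
  proof (rule bij_betw_byWitness[where f' = "map g"])
    show "map h ` residue_free n {1..card S} \<subseteq> residue_free n S"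
      using bij res by (auto simp: residue_free_def bij_betw_def)
    show "map g ` residue_free n S \<subseteq> residue_free n {1..card S}"
    proof
      fix v assume "v \<in> map g ` residue_free n S"
      then obtain w where w: "v = map g w" "length w = n" "set w = S" "residue w = []"
        by (auto simp: residue_free_def)
      have "residue v = []" using res[OF setg[OF w(3)]] hg[OF w(3)] w by simp
      then show "v \<in> residue_free n {1..card S}"
        using w setg[OF w(3)] by (simp add: residue_free_def)
    qed
  qed (use gh hg in \<open>auto simp: residue_free_def simp del: map_map\<close>)
  then show ?thesis using bij_betw_same_card by metis
qed

lemma residue_free_no_one:
  assumes "0 < n" "1 \<notin> S"
  shows "residue_free n S = {}"
  using assms last_eq_1_if_residue_Nil last_in_set
  by (fastforce simp: residue_free_def)

lemma centralizer_count_eq_sum_residue_free: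
  "centralizer_count n m [1] = (\<Sum>S\<in>Pow {1..m}. card (residue_free n S))"
proof -
  have "{w \<in> centralizer [1]. length w = n \<and> (\<forall>x\<in>set w. x \<le> m)} =
      (\<Union>S\<in>Pow {1..m}. residue_free n S)"
  proof (rule set_eqI)
    fix w
    have "(\<forall>x\<in>set w. 1 \<le> x) \<and> (\<forall>x\<in>set w. x \<le> m) \<longleftrightarrow> set w \<in> Pow {1..m}"
      by (auto simp: subset_iff)
    then show "w \<in> {w \<in> centralizer [1]. length w = n \<and> (\<forall>x\<in>set w. x \<le> m)} \<longleftrightarrow>
        w \<in> (\<Union>S\<in>Pow {1..m}. residue_free n S)"
      unfolding centralizer_one_iff[unfolded is_word_def] residue_free_def mem_Collect_eq UN_iff
      by blast
  qed
  moreover have "card (\<Union>S\<in>Pow {1..m}. residue_free n S) =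
      (\<Sum>S\<in>Pow {1..m}. card (residue_free n S))"
  proof (rule card_UN_disjoint)
    show "\<forall>S\<in>Pow {1..m}. finite (residue_free n S)"
      using finite_residue_free finite_subset by blast
    show "\<forall>S\<in>Pow {1..m}. \<forall>S'\<in>Pow {1..m}. S \<noteq> S' \<longrightarrow> residue_free n S \<inter> residue_free n S' = {}"
      unfolding residue_free_def by blast
  qed simp
  ultimately show ?thesis by (simp only: centralizer_count_def)
qed

lemma sum_Pow_card:
  fixes f :: "nat \<Rightarrow> 'a::semiring_1"
  assumes "finite A"
  shows "(\<Sum>S\<in>Pow A. f (card S)) = (\<Sum>k\<le>card A. of_nat (card A choose k) * f k)"
proof -
  have "(\<Sum>S\<in>Pow A. f (card S)) =
      (\<Sum>k\<le>card A. \<Sum>S\<in>{S\<in>Pow A. card S = k}. f (card S))"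
    by (rule sum.group[symmetric]) (use assms card_mono in auto)
  also have "\<dots> = (\<Sum>k\<le>card A. of_nat (card A choose k) * f k)"
    by (rule sum.cong) (auto simp: n_subsets[OF assms, symmetric] Pow_def)
  finally show ?thesis .
qed

lemma lower_count_0: "0 < n \<Longrightarrow> lower_count n 0 = 0"
  by (auto simp: lower_count_def residue_free_def card_eq_0_iff)

lemma centralizer_count_eq:
  assumes "2 \<le> n"
  shows "centralizer_count n m [1] = (\<Sum>k\<le>m. (m choose k) * lower_count n k)"
proof (cases m)
  case 0
  have "residue_free n {} = {}" using residue_free_no_one assms by simp
  then show ?thesis
    using 0 assms lower_count_0
    by (simp add: centralizer_count_eq_sum_residue_free del: One_nat_def)
next
  case (Suc m')
  let ?P = "Pow {2..m}"
  have ins: "{1..m} = insert 1 {2..m}" using Suc by auto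
  have disj: "?P \<inter> insert 1 ` ?P = {}" by auto
  have "1 \<notin> S" if "S \<in> ?P" for S using that by auto
  then have inj: "inj_on (insert 1) ?P" by (intro inj_onI) (metis insert_ident)
  have split: "(\<Sum>S\<in>Pow {1..m}. g S) = (\<Sum>S\<in>?P. g S) + (\<Sum>S\<in>?P. g (insert 1 S))"
    for g :: "nat set \<Rightarrow> nat"
    unfolding ins Pow_insert using disj inj by (simp add: sum.union_disjoint sum.reindex)
  \<comment> \<open>The set \<open>S\<close> without 1 admits no word, and the two terms counting
    words on \<open>insert 1 S\<close> are shared out between the two sets.\<close>
  have "card (residue_free n S) + card (residue_free n (insert 1 S)) =
      lower_count n (card S) + lower_count n (card (insert 1 S))" if "S \<in> ?P" for S
  proof -
    have S: "finite S" "1 \<notin> S" "0 \<notin> S" using that finite_subset[of S "{2..m}"] by auto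
    have "card (residue_free n (insert 1 S)) = card (residue_free n {1..Suc (card S)})"
      using card_residue_free_relabel[of "insert 1 S" n] S by simp
    then show ?thesis
      using S residue_free_no_one[of n S] card_residue_free[OF assms] assms by simp
  qed
  then have "(\<Sum>S\<in>Pow {1..m}. card (residue_free n S)) = (\<Sum>S\<in>Pow {1..m}. lower_count n (card S))"
    unfolding split sum.distrib[symmetric] by (rule sum.cong[OF refl])
  then show ?thesis
    using sum_Pow_card[of "{1..m}" "lower_count n"]
    by (simp add: centralizer_count_eq_sum_residue_free del: One_nat_def)
qed

section \<open>Values of the coefficients\<close>

lemma not_distinct_if_tie: "tie w l \<Longrightarrow> \<not> distinct w"
  by (auto simp: tie_def)

text \<open>A word of length \<open>n\<close> with at least \<open>n\<close> letters repeats none.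
  So it has no tie and cannot both start and end with 1, as a lower word without ascents
  would.\<close>

lemma lower_count_eq_0:
  assumes "2 \<le> n" "n \<le> k"
  shows "lower_count n k = 0"
proof -
  have "\<not> lower w" if w: "w \<in> residue_free n {1..k}" for w
  proof
    assume low: "lower w"
    have "distinct w"
      using w assms(2) card_length[of w] by (auto simp: residue_free_def intro!: card_distinct)
    then have tie: "\<not> tie w l" for l using not_distinct_if_tie by blast
    then have "hd w = 1" using low by (auto simp: lower_def split: if_splits)
    then obtain t where t: "w = 1 # t" "t \<noteq> []"
      using w assms(1) by (cases w; cases "tl w") (auto simp: residue_free_def)
    then have "last t = 1"
      using last_eq_1_if_residue_Nil[of w] w by (auto simp: residue_free_def)
    then show False using t \<open>distinct w\<close> last_in_set[of t] by auto
  qed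
  then have "{w \<in> residue_free n {1..k}. lower w} = {}" by blast
  then show ?thesis by (simp only: lower_count_def card.empty)
qed

definition lower_witness :: "nat \<Rightarrow> nat \<Rightarrow> nat list" where
  "lower_witness n k = replicate (n - k) 1 @ rev [1..<Suc k]"

text \<open>The word is falling and ends in 1, so its residue is empty and being lower only requires
  the leading 1, which \<open>k < n\<close> provides.\<close>

lemma lower_witness:
  assumes "1 \<le> k" "k < n"
  shows "lower_witness n k \<in> residue_free n {1..k} \<and> lower (lower_witness n k)"
proof -
  let ?w = "lower_witness n k"
  have set: "set ?w = {1..k}" using assms by (auto simp: lower_witness_def simp del: upt_Suc)
  have dec: "sorted_wrt (>) (rev [1..<Suc k])"
    by (simp add: sorted_wrt_rev del: upt_Suc)
  have fall: "falling ?w"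
    using sorted_wrt_filter[OF dec] by (simp add: falling_def lower_witness_def del: upt_Suc)
  then have no: "\<nexists>l. ascent ?w l" using no_ascent_iff_falling[OF set] by blast
  have hd: "hd ?w = 1" using assms by (cases "n - k") (auto simp: lower_witness_def)
  have "[1..<Suc k] = 1 # [2..<Suc k]"
    using assms by (simp add: upt_conv_Cons numeral_2_eq_2 del: upt_Suc)
  then have "last ?w = 1" "?w \<noteq> []" by (simp_all add: lower_witness_def del: upt_Suc)
  then have "residue ?w = []" using residue_falling[OF fall] by simp
  moreover have "length ?w = n" using assms by (simp add: lower_witness_def del: upt_Suc)
  ultimately show ?thesis using set no hd by (simp add: residue_free_def lower_def)
qed

lemma lower_count_pos:
  assumes "1 \<le> k" "k < n"
  shows "0 < lower_count n k"
  using lower_witness[OF assms] finite_residue_free[of "{1..k}" n]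
  by (auto simp: lower_count_def card_gt_0_iff)

lemma lower_count_1:
  assumes "1 < n"
  shows "lower_count n 1 = 1"
proof -
  have "w = lower_witness n 1" if "w \<in> residue_free n {1..1}" for w
  proof -
    have "w = replicate n 1" using that by (auto simp: residue_free_def intro!: replicate_eqI)
    then show ?thesis using assms by (cases n) (auto simp: lower_witness_def replicate_append_same)
  qed
  then have "{w \<in> residue_free n {1..1}. lower w} = {lower_witness n 1}"
    using lower_witness[of 1 n] assms by auto
  then show ?thesis by (simp add: lower_count_def)
qed

text \<open>With \<open>n - 1\<close> letters on \<open>n\<close> places only one repetition is
  possible. A lower word must spend it on the 1 at both ends, and the rest is decreasing.\<close>

lemma lower_count_top:
  assumes "2 \<le> n"
  shows "lower_count n (n - 1) = 1"
proof -
  have "w = 1 # rev [1..<n]" if w: "w \<in> residue_free n {1..n - 1}" "lower w" for w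
  proof -
    have W: "length w = n" "set w = {1..n - 1}" "residue w = []"
      using w(1) by (auto simp: residue_free_def)
    have no: "\<nexists>l. ascent w l"
    proof
      assume ex: "\<exists>l. ascent w l"
      then have "\<not> falling w" using no_ascent_iff_falling[OF W(2)] by blast
      moreover have "count_list w 1 \<noteq> 0" using W(2) assms by (auto simp: count_list_0_iff)
      ultimately have "2 \<le> count_list w 1"
        using falling_if_single_one[OF W(3)] by linarith
      define l where "l = (LEAST l. ascent w l)"
      have "2 \<le> l" using LeastI_ex[OF ex] by (simp add: ascent_def l_def)
      obtain u v where uv: "w = u @ l # v" "l \<in> set v"
        using w(2) ex by (auto simp: lower_def l_def tie_def)
      \<comment> \<open>Deleting one copy of the tied letter uses up the only repetition, yet two 1s
        remain.\<close>
      have "set (u @ v) = {1..n - 1}" using W(2) uv by auto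
      moreover have "length (u @ v) = n - 1" using W(1) uv by simp
      ultimately have "distinct (u @ v)" by (intro card_distinct) simp
      moreover have "tie (u @ v) 1"
        using \<open>2 \<le> count_list w 1\<close> \<open>2 \<le> l\<close> uv by (simp add: tie_iff_count_list)
      ultimately show False using not_distinct_if_tie by blast
    qed
    then have fall: "falling w" "hd w = 1"
      using no_ascent_iff_falling[OF W(2)] w(2) by (auto simp: lower_def)
    then obtain t where t: "w = 1 # t" "t \<noteq> []"
      using W(1) assms by (cases w; cases "tl w") auto
    have last: "last t = 1" using last_eq_1_if_residue_Nil[OF W(3)] t by auto
    then obtain v where v: "t = v @ [1]" using t(2) by (metis append_butlast_last_id)
    have sett: "set t = {1..n - 1}" using W(2) t v by auto
    then have "distinct t" using W(1) t by (intro card_distinct) simp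
    then have "1 \<notin> set v" using v by auto
    moreover have "\<forall>x\<in>set v. 1 \<le> x" using sett v by auto
    moreover have "filter (\<lambda>x. x \<noteq> 1) w = v"
      using t v \<open>1 \<notin> set v\<close> by (auto simp: filter_id_conv)
    ultimately have "sorted_wrt (>) t"
      using fall(1) v by (auto simp: falling_def sorted_wrt_append le_neq_implies_less)
    then have "sorted_wrt (<) (rev t)" by (simp add: sorted_wrt_rev)
    moreover have "set (rev t) = set [1..<n]"
    proof -
      have "{1..n - 1} = {1..<n}" using assms by auto
      then show ?thesis using sett by (simp only: set_rev set_upt)
    qed
    ultimately have "rev t = [1..<n]"
      using strict_sorted_equal[of "rev t" "[1..<n]"] by simp
    then show ?thesis using t(1) by (metis rev_rev_ident)
  qed
  moreover have "{w \<in> residue_free n {1..n - 1}. lower w} \<noteq> {}"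
  proof -
    have "1 \<le> n - 1" "n - 1 < n" using assms by auto
    then show ?thesis using lower_witness[of "n - 1" n] by blast
  qed
  ultimately have "{w \<in> residue_free n {1..n - 1}. lower w} = {1 # rev [1..<n]}"
    by blast
  then show ?thesis by (simp add: lower_count_def)
qed

section \<open>Words in two letters as reflected walks\<close>

definition two_letter_words :: "nat \<Rightarrow> nat \<Rightarrow> nat list set" where
  "two_letter_words n h = {w. length w = n \<and> set w \<subseteq> {1, 2} \<and> length (residue w) = h}"

lemma length_residue_snoc_two:
  assumes "set w \<subseteq> {1, 2}"
  shows "length (residue (w @ [2])) = Suc (length (residue w))"
proof -
  have "residue w = replicate (length (residue w)) 2"
    using set_residue[of w] assms by (intro replicate_eqI) auto
  moreover have "fst (row_insert (replicate h 2) (2::nat)) = replicate (Suc h) 2" for h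
    by (induction h) (auto split: prod.splits)
  ultimately show ?thesis
    by (metis One_nat_def length_replicate numeral_eq_one_iff residue_snoc residue_step_def semiring_norm(85))
qed

lemma length_residue_snoc_one: "length (residue (w @ [1])) = length (residue w) - 1"
  by (simp add: residue_step_def)

text \<open>The height of the walk is the length of the residue: 2 steps up, 1 steps down. Truncated
  subtraction makes a down step at height 0 stay there.\<close>

lemma snoc_two_letter_words_iff:
  "w @ [x] \<in> two_letter_words (Suc n) h \<longleftrightarrow>
    x = 1 \<and> (\<exists>j. w \<in> two_letter_words n j \<and> h = j - 1) \<or>
    x = 2 \<and> (\<exists>j. w \<in> two_letter_words n j \<and> h = Suc j)"
  unfolding two_letter_words_def
  using length_residue_snoc_one[of w] length_residue_snoc_two[of w]
  by (auto simp del: residue_snoc One_nat_def)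

lemma two_letter_words_Suc_0:
  "two_letter_words (Suc n) 0 = (\<lambda>w. w @ [1]) ` (two_letter_words n 0 \<union> two_letter_words n 1)"
proof (rule set_eqI)
  fix w :: "nat list"
  have "[] \<notin> two_letter_words (Suc n) h" for h by (simp add: two_letter_words_def)
  moreover have "0 = j - 1 \<longleftrightarrow> j = 0 \<or> j = 1" for j :: nat by auto
  ultimately show "w \<in> two_letter_words (Suc n) 0 \<longleftrightarrow>
      w \<in> (\<lambda>w. w @ [1]) ` (two_letter_words n 0 \<union> two_letter_words n 1)"
    by (cases w rule: rev_cases) (auto simp: snoc_two_letter_words_iff simp del: One_nat_def)
qed

lemma two_letter_words_Suc_Suc:
  "two_letter_words (Suc n) (Suc h) =
    (\<lambda>w. w @ [2]) ` two_letter_words n h \<union> (\<lambda>w. w @ [1]) ` two_letter_words n (Suc (Suc h))"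
proof (rule set_eqI)
  fix w :: "nat list"
  have "[] \<notin> two_letter_words (Suc n) h" for h by (simp add: two_letter_words_def)
  moreover have "Suc h = j - 1 \<longleftrightarrow> j = Suc (Suc h)" for j :: nat by auto
  ultimately show "w \<in> two_letter_words (Suc n) (Suc h) \<longleftrightarrow>
      w \<in> (\<lambda>w. w @ [2]) ` two_letter_words n h \<union> (\<lambda>w. w @ [1]) ` two_letter_words n (Suc (Suc h))"
    by (cases w rule: rev_cases) (auto simp: snoc_two_letter_words_iff simp del: One_nat_def)
qed

lemma card_two_letter_words:
  "card (two_letter_words n h) = (if h \<le> n then n choose ((n - h) div 2) else 0)"
proof (induction n arbitrary: h)
  case 0
  have "two_letter_words 0 h = (if h = 0 then {[]} else {})" by (auto simp: two_letter_words_def)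
  then show ?case by simp
next
  case (Suc n)
  have fin: "finite (two_letter_words n h)" for h
    by (rule finite_subset[OF _ finite_lists_length_eq[of "{1, 2}" n]])
       (auto simp: two_letter_words_def)
  have inj: "inj_on (\<lambda>w. w @ [x]) A" for x :: nat and A by (simp add: inj_on_def)
  show ?case
  proof (cases h)
    case 0
    have "card (two_letter_words (Suc n) 0) = card (two_letter_words n 0) + card (two_letter_words n 1)"
      unfolding two_letter_words_Suc_0 card_image[OF inj]
      by (rule card_Un_disjoint) (auto simp: fin, auto simp: two_letter_words_def)
    also have "\<dots> = (n choose (n div 2)) + (if 1 \<le> n then n choose ((n - 1) div 2) else 0)"
      unfolding Suc.IH by simp
    also have "\<dots> = Suc n choose (Suc n div 2)"
    \<comment> \<open>For even \<open>n\<close> this is Pascal's rule; for odd \<open>n\<close> both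
      terms are the same middle binomial, and symmetry turns one into its neighbour.\<close>
    proof (cases "even n")
      case True
      then obtain k where "n = 2 * k" by (auto elim: evenE)
      then show ?thesis by (cases k) auto
    next
      case False
      then obtain k where n: "n = 2 * k + 1" by (auto elim: oddE)
      have "n choose k = n choose Suc k" using binomial_symmetric[of k n] n by simp
      then show ?thesis using n by simp
    qed
    finally show ?thesis using 0 by simp
  next
    case (Suc h')
    have "card (two_letter_words (Suc n) (Suc h')) =
        card (two_letter_words n h') + card (two_letter_words n (Suc (Suc h')))"
      unfolding two_letter_words_Suc_Suc
      by (subst card_Un_disjoint) (auto simp: fin card_image[OF inj])
    also have "\<dots> = (if h' \<le> n then Suc n choose ((n - h') div 2) else 0)"
    proof (cases "Suc (Suc h') \<le> n")
      case True
      then obtain d where "n = Suc (Suc h') + d" using le_iff_add by blast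
      then show ?thesis unfolding Suc.IH by simp
    next
      case False
      \<comment> \<open>At the top heights only the walk from below contributes, and the lower index
        of the binomials is 0.\<close>
      then have "h' \<le> n \<Longrightarrow> n - h' = 0 \<or> n - h' = 1" by auto
      then show ?thesis using False unfolding Suc.IH by auto
    qed
    finally show ?thesis using Suc by simp
  qed
qed

text \<open>Evaluation at \<open>m = 2\<close> gives
  \<open>e\<^sub>0 + 2 e\<^sub>1 + e\<^sub>2\<close> with \<open>e\<^sub>0 = 0\<close> and
  \<open>e\<^sub>1 = 1\<close>, while the walks ending at height 0 give the central binomial. Adding
  2 on the left avoids truncated subtraction.\<close>

lemma lower_count_2:
  assumes "2 \<le> n"
  shows "lower_count n 2 + 2 = n choose (n div 2)"
proof -
  have "{w \<in> centralizer [1]. length w = n \<and> (\<forall>x\<in>set w. x \<le> 2)} = two_letter_words n 0"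
  proof -
    have "(1 \<le> x \<and> x \<le> 2) = (x \<in> {1, 2})" for x :: nat by auto
    then show ?thesis
      unfolding centralizer_one_iff is_word_def two_letter_words_def subset_iff by auto
  qed
  then have "centralizer_count n 2 [1] = n choose (n div 2)"
    using card_two_letter_words[of n 0] by (simp add: centralizer_count_def)
  moreover have "centralizer_count n 2 [1] = lower_count n 2 + 2"
  proof -
    have "{..2} = {0, 1, 2 :: nat}" by auto
    then show ?thesis
      using lower_count_1[of n] lower_count_0[of n] assms centralizer_count_eq[OF assms, of 2]
      by simp
  qed
  ultimately show ?thesis by simp
qed

section \<open>Uniqueness and polynomiality of the expansion\<close>

lemma binomial_expansion_unique:
  assumes "binomial_expansion f d a" "binomial_expansion f d b"
  shows "a = b"
proof
  fix k
  show "a k = b k"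
  proof (induction k rule: less_induct)
    case (less k)
    show ?case
    proof (cases "k \<le> d")
      case True
      \<comment> \<open>Evaluation at \<open>k\<close> is triangular: coefficients beyond
        \<open>k\<close> are multiplied by 0 and \<open>c k\<close> by 1.\<close>
      have *: "real (f k) = (\<Sum>j<k. c j * real (k choose j)) + c k"
        if "binomial_expansion f d c" for c
      proof -
        have "real (f k) = (\<Sum>j=0..d. c j * real (k choose j))"
          using that by (simp add: binomial_expansion_def)
        also have "\<dots> = (\<Sum>j\<le>k. c j * real (k choose j))"
          by (rule sum.mono_neutral_right) (use True in auto)
        finally show ?thesis by (simp flip: lessThan_Suc_atMost)
      qed
      show ?thesis using *[OF assms(1)] *[OF assms(2)] less by simp
    qed (use assms in \<open>simp add: binomial_expansion_def\<close>)
  qed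
qed

lemma binomial_expansion_lower_count:
  assumes "2 \<le> n"
  shows "binomial_expansion (\<lambda>m. centralizer_count n m [1]) (n - 1) (\<lambda>k. real (lower_count n k))"
  unfolding binomial_expansion_def
proof (intro conjI allI impI)
  fix m
  \<comment> \<open>The bound \<open>m + n\<close> exceeds both ranges: the binomials vanish above
    \<open>m\<close>, the coefficients from \<open>n\<close> on.\<close>
  have "(\<Sum>k\<le>m. (m choose k) * lower_count n k) = (\<Sum>k\<le>m + n. (m choose k) * lower_count n k)"
    by (rule sum.mono_neutral_left) auto
  also have "\<dots> = (\<Sum>k=0..n - 1. (m choose k) * lower_count n k)"
    by (rule sum.mono_neutral_right) (use assms lower_count_eq_0 in auto)
  finally show "real (centralizer_count n m [1]) =
      (\<Sum>k=0..n - 1. real (lower_count n k) * real (m choose k))"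
    by (simp add: centralizer_count_eq[OF assms] mult.commute del: One_nat_def)
qed (use assms lower_count_eq_0 in auto)

text \<open>Each \<open>m choose k\<close> is a falling factorial divided by \<open>fact k\<close>,
  a polynomial in \<open>m\<close> of degree \<open>k\<close>; since \<open>a d \<noteq> 0\<close>,
  the top term cannot be cancelled.\<close>

lemma binomial_expansion_poly:
  assumes "binomial_expansion f d a" "a d \<noteq> 0"
  shows "\<exists>p :: real poly. degree p = d \<and> (\<forall>m. real (f m) = poly p (real m))"
proof -
  define q :: "nat \<Rightarrow> real poly" where
    "q k = smult (a k / fact k) (\<Prod>i=0..<k. [:- of_nat i, 1:])" for k
  have deg_prod: "degree (\<Prod>i=0..<k. [:- of_nat i, 1 :: real:]) = k" for k
    by (subst degree_prod_eq_sum_degree) auto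
  have "poly (q k) (real m) = a k * real (m choose k)" for k m
    by (simp add: q_def poly_prod binomial_gbinomial gbinomial_prod_rev)
  then have "real (f m) = poly (\<Sum>k=0..d. q k) (real m)" for m
    using assms(1) by (simp add: binomial_expansion_def poly_sum)
  moreover have "degree (\<Sum>k=0..d. q k) = d"
  proof (cases d)
    case 0
    then show ?thesis by (simp add: q_def)
  next
    case (Suc d')
    have "degree (\<Sum>k=0..d'. q k) \<le> d'"
      by (rule degree_sum_le) (auto simp: q_def deg_prod)
    moreover have "degree (q d) = d" using assms(2) by (simp add: q_def deg_prod)
    ultimately show ?thesis using Suc by (simp add: degree_add_eq_right)
  qed
  ultimately show ?thesis by blast
qed

theorem theorem4p2:
  fixes n :: nat
  assumes "n \<ge> 2"
  shows "(\<exists>p :: real poly. degree p = n - 1 \<and>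
            (\<forall>m. real (centralizer_count n m [1]) = poly p (real m))) \<and>
         (\<exists>a. binomial_expansion (\<lambda>m. centralizer_count n m [1]) (n - 1) a) \<and>
         (\<forall>a. binomial_expansion (\<lambda>m. centralizer_count n m [1]) (n - 1) a \<longrightarrow>
            a 0 = 0 \<and>
            a 1 = 1 \<and>
            a 2 = real (n choose (n div 2)) - 2 \<and>
            a (n - 1) = 1 \<and>
            (\<forall>i\<in>{1..n - 1}. a i \<in> \<int> \<and> a i > 0))"
proof -
  note exp = binomial_expansion_lower_count[OF assms]
  have top: "lower_count n (n - 1) = 1" using lower_count_top[OF assms] .
  have pos: "\<forall>i\<in>{1..n - 1}. 0 < lower_count n i"
    using lower_count_pos[of _ n] assms by auto
  have two: "real (lower_count n 2) = real (n choose (n div 2)) - 2"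
    unfolding lower_count_2[OF assms, symmetric] by simp
  have coeff: "a = (\<lambda>k. real (lower_count n k))"
    if "binomial_expansion (\<lambda>m. centralizer_count n m [1]) (n - 1) a" for a
    by (rule binomial_expansion_unique[OF that exp])
  show ?thesis
  proof (intro conjI allI impI)
    show "\<exists>p :: real poly. degree p = n - 1 \<and>
        (\<forall>m. real (centralizer_count n m [1]) = poly p (real m))"
      using binomial_expansion_poly[OF exp] top by simp
    show "\<exists>a. binomial_expansion (\<lambda>m. centralizer_count n m [1]) (n - 1) a"
      using exp by blast
  qed (use coeff top pos two lower_count_0[of n] lower_count_1[of n] assms
       in \<open>auto dest!: coeff simp del: One_nat_def\<close>)
qed

end
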